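(* Let $m\geqslant 3$, $n\geqslant 3$ be odd integers and let $M\geqslant m$, $N\geqslant n$ be odd integers. Then the labelings $\mathrm{HALL}_{M,N}(m,n)$ and $\mathrm{VALL}_{M,N}(m,n)$ are partial bicentrally balanced $C_4$-face-magic labelings on the $m\times n$ subgrid of $\mathcal{P}_{M,N}$.
   Context: Write $m=2m_0+1$, $n=2n_0+1$, $m_0^{+}=m_0+1$, $n_0^{+}=n_0+1$. $\mathrm{Grid}(m,n)=\{(i,j):1\leqslant i\leqslant m,1\leqslant j\leqslant n\}$, and $P_m\times P_n$ is the planar $m\times n$ grid graph on it (edges $(i,j)$–$(i+1,j)$ and $(i,j)$–$(i,j+1)$), whose 4-cycle faces are $\{(i,j),(i+1,j),(i,j+1),(i+1,j+1)\}$, $1\leqslant i\leqslant m-1$, $1\leqslant j\leqslant n-1$. A labeling $X=\{x_{i,j}:(i,j)\in\mathrm{Grid}(m,n)\}$ is a partial bicentrally balanced $C_4$-face-magic labeling on the $m\times n$ subgrid of $\mathcal{P}_{M,N}$ if: (1) every 4-cycle face of $P_m\times P_n$ has label sum $2MN+3$; (2) $\{x_{i,j}: i+j \text{ even}\}=\{1,2,\ldots,\tfrac12 mn+\tfrac12\}$; (3) $\{x_{i,j}: i+j\text{ odd}\}=\{MN-\tfrac12 mn+\tfrac32, MN-\tfrac12 mn+\tfrac52,\ldots,MN\}$; (4) $x_{i,j}+x_{m+1-i,n+1-j}=\tfrac12 mn+\tfrac32$ if $i+j$ is even; (5) $x_{i,j}+x_{m+1-i,n+1-j}=2MN-\tfrac12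 mn+\tfrac32$ if $i+j$ is odd; (6) $x_{i,n_0^{+}}<x_{i+2,n_0^{+}}$ for $1\leqslant i\leqslant m-2$ with $i+n_0^{+}$ even, $x_{i,n_0^{+}}>x_{i+2,n_0^{+}}$ for $1\leqslant i\leqslant m-2$ with $i+n_0^{+}$ odd, $x_{m_0^{+},j}<x_{m_0^{+},j+2}$ for $1\leqslant j\leqslant n-2$ with $m_0^{+}+j$ even, and $x_{m_0^{+},j}>x_{m_0^{+},j+2}$ for $1\leqslant j\leqslant n-2$ with $m_0^{+}+j$ odd. $\mathrm{HALL}_{M,N}(m,n)=\{x_{i,j}\}$ is given by: $x_{2i-1,2j-1}=m(j-1)+i$ ($1\leqslant i\leqslant m_0^{+}$, $1\leqslant j\leqslant n_0^{+}$); $x_{2i,2j}=m(j-1)+m_0^{+}+i$ ($1\leqslant i\leqslant m_0$, $1\leqslant j\leqslant n_0$); $x_{2i,2j-1}=MN+m(1-j)+1-i$ ($1\leqslant i\leqslant m_0$, $1\leqslant j\leqslant n_0^{+}$); $x_{2i-1,2j}=MN-mj+m_0^{+}+1-i$ ($1\leqslant i\leqslant m_0^{+}$, $1\leqslant j\leqslant n_0$). $\mathrm{VALL}_{M,N}(m,n)=\{y_{i,j}\}$ is given by: $y_{2i-1,2j-1}=n(i-1)+j$ ($1\leqslant i\leqslant m_0^{+}$, $1\leqslant j\leqslant n_0^{+}$); $y_{2i,2j}=n(i-1)+n_0^{+}+j$ ($1\leqslant i\leqslant m_0$, $1\leqslant j\leqslant n_0$); $y_{2i,2j-1}=MN-ni+n_0^{+}+1-j$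 ($1\leqslant i\leqslant m_0$, $1\leqslant j\leqslant n_0^{+}$); $y_{2i-1,2j}=MN+n(1-i)+1-j$ ($1\leqslant i\leqslant m_0^{+}$, $1\leqslant j\leqslant n_0$). *)

theory Defs
  imports Main
begin

definition Grid :: "int \<Rightarrow> int \<Rightarrow> (int \<times> int) set" where
  "Grid m n = {(i, j). 1 \<le> i \<and> i \<le> m \<and> 1 \<le> j \<and> j \<le> n}"

definition C4_faces :: "int \<Rightarrow> int \<Rightarrow> (int \<times> int) set set" where
  "C4_faces m n = {{(i, j), (i + 1, j), (i, j + 1), (i + 1, j + 1)} | i j.
     1 \<le> i \<and> i \<le> m - 1 \<and> 1 \<le> j \<and> j \<le> n - 1}"

definition half_floor :: "int \<Rightarrow> int" where
  "half_floor m = (m - 1) div 2"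

definition half_ceil :: "int \<Rightarrow> int" where
  "half_ceil m = half_floor m + 1"

text \<open>
  For \<open>m = 2 m\<^sub>0 + 1\<close> these are \<open>m\<^sub>0\<close> and \<open>m\<^sub>0 + 1\<close>. A labeling is a function
  \<open>x\<close> on pairs of indices, of which only the values on the grid matter. The predicate below is meant
  for odd \<open>m\<close>, \<open>n\<close>: then \<open>m * n\<close> is odd and every division by 2 in it is exact.
\<close>

definition partial_bicentrally_balanced ::
  "int \<Rightarrow> int \<Rightarrow> int \<Rightarrow> int \<Rightarrow> (int \<Rightarrow> int \<Rightarrow> int) \<Rightarrow> bool" where
  "partial_bicentrally_balanced M N m n x \<longleftrightarrow>
     (\<forall>F \<in> C4_faces m n. (\<Sum>(i, j) \<in> F. x i j) = 2 * M * N + 3) \<and>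
     {x i j | i j. (i, j) \<in> Grid m n \<and> even (i + j)} = {1 .. (m * n + 1) div 2} \<and>
     {x i j | i j. (i, j) \<in> Grid m n \<and> odd (i + j)} = {M * N - (m * n - 3) div 2 .. M * N} \<and>
     (\<forall>(i, j) \<in> Grid m n. even (i + j) \<longrightarrow>
        x i j + x (m + 1 - i) (n + 1 - j) = (m * n + 3) div 2) \<and>
     (\<forall>(i, j) \<in> Grid m n. odd (i + j) \<longrightarrow>
        x i j + x (m + 1 - i) (n + 1 - j) = 2 * M * N - (m * n - 3) div 2) \<and>
     (\<forall>i. 1 \<le> i \<and> i \<le> m - 2 \<and> even (i + half_ceil n) \<longrightarrow>
        x i (half_ceil n) < x (i + 2) (half_ceil n)) \<and>
     (\<forall>i. 1 \<le> i \<and> i \<le> m - 2 \<and> odd (i + half_ceil n) \<longrightarrow>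
        x i (half_ceil n) > x (i + 2) (half_ceil n)) \<and>
     (\<forall>j. 1 \<le> j \<and> j \<le> n - 2 \<and> even (half_ceil m + j) \<longrightarrow>
        x (half_ceil m) j < x (half_ceil m) (j + 2)) \<and>
     (\<forall>j. 1 \<le> j \<and> j \<le> n - 2 \<and> odd (half_ceil m + j) \<longrightarrow>
        x (half_ceil m) j > x (half_ceil m) (j + 2))"

text \<open>
  The labelings are specified by four families of equations, according to the parities of the two
  indices. Both \<open>2 a - 1\<close> and \<open>2 a\<close> determine \<open>a\<close> as \<open>(i + 1) div 2\<close>. The
  original parametrized equations are recovered in \<open>HALL_eqs\<close> and \<open>VALL_eqs\<close>.
\<close>

definition HALL :: "int \<Rightarrow> int \<Rightarrow> int \<Rightarrow> int \<Rightarrow> int \<Rightarrow> int \<Rightarrow> int" where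
  "HALL M N m n i j =
    (let a = (i + 1) div 2; b = (j + 1) div 2 in
     if odd i \<and> odd j then m * (b - 1) + a
     else if even i \<and> even j then m * (b - 1) + half_ceil m + a
     else if even i \<and> odd j then M * N + m * (1 - b) + 1 - a
     else M * N - m * b + half_ceil m + 1 - a)"

definition VALL :: "int \<Rightarrow> int \<Rightarrow> int \<Rightarrow> int \<Rightarrow> int \<Rightarrow> int \<Rightarrow> int" where
  "VALL M N m n i j =
    (let a = (i + 1) div 2; b = (j + 1) div 2 in
     if odd i \<and> odd j then n * (a - 1) + b
     else if even i \<and> even j then n * (a - 1) + half_ceil n + b
     else if even i \<and> odd j then M * N - n * a + half_ceil n + 1 - b
     else M * N + n * (1 - a) + 1 - b)"

lemma HALL_eqs:
  "HALL M N m n (2 * i - 1) (2 * j - 1) = m * (j - 1) + i"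
  "HALL M N m n (2 * i) (2 * j) = m * (j - 1) + half_ceil m + i"
  "HALL M N m n (2 * i) (2 * j - 1) = M * N + m * (1 - j) + 1 - i"
  "HALL M N m n (2 * i - 1) (2 * j) = M * N - m * j + half_ceil m + 1 - i"
  by (simp_all add: HALL_def)

lemma VALL_eqs:
  "VALL M N m n (2 * i - 1) (2 * j - 1) = n * (i - 1) + j"
  "VALL M N m n (2 * i) (2 * j) = n * (i - 1) + half_ceil n + j"
  "VALL M N m n (2 * i) (2 * j - 1) = M * N - n * i + half_ceil n + 1 - j"
  "VALL M N m n (2 * i - 1) (2 * j) = M * N + n * (1 - i) + 1 - j"
  by (simp_all add: VALL_def)

end

theory Submission
  imports Defs
begin

text \<open>
  Cut \<open>1, 2, 3, \<dots>\<close> into blocks of alternately \<open>c\<close> and \<open>m - c\<close> numbers. Going through the columns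
  from left to right, \<open>HALL\<close> fills the cells of even parity with these blocks upwards from 1, for
  \<open>c = m\<^sub>0 + 1\<close>, and the cells of odd parity downwards from \<open>M N\<close>, for \<open>c = m\<^sub>0\<close>. The remaining
  conditions are identities in the parametrized equations. Exchanging the two coordinates turns
  \<open>HALL\<close> into \<open>VALL\<close> and preserves all conditions.
\<close>

lemma even_or_pred_even_int:
  fixes i :: int
  obtains (even) a where "i = 2 * a" | (odd) a where "i = 2 * a - 1"
proof (cases "even i")
  case True
  then show ?thesis by (elim evenE that(1))
next
  case False
  then obtain a where "i = 2 * a + 1" by (rule oddE)
  then have "i = 2 * (a + 1) - 1" by simp
  then show ?thesis by (rule that(2))
qed

lemma Grid_parity_iff:
  "(2 * a - 1, 2 * b - 1) \<in> Grid m n \<longleftrightarrow> (a, b) \<in> Grid ((m + 1) div 2) ((n + 1) div 2)"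
  "(2 * a, 2 * b) \<in> Grid m n \<longleftrightarrow> (a, b) \<in> Grid (m div 2) (n div 2)"
  "(2 * a, 2 * b - 1) \<in> Grid m n \<longleftrightarrow> (a, b) \<in> Grid (m div 2) ((n + 1) div 2)"
  "(2 * a - 1, 2 * b) \<in> Grid m n \<longleftrightarrow> (a, b) \<in> Grid ((m + 1) div 2) (n div 2)"
  by (auto simp: Grid_def)

lemma Grid_parity_Un:
  "Grid m n =
    (\<lambda>(a, b). (2 * a - 1, 2 * b - 1)) ` Grid ((m + 1) div 2) ((n + 1) div 2) \<union>
    (\<lambda>(a, b). (2 * a, 2 * b)) ` Grid (m div 2) (n div 2) \<union>
    (\<lambda>(a, b). (2 * a, 2 * b - 1)) ` Grid (m div 2) ((n + 1) div 2) \<union>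
    (\<lambda>(a, b). (2 * a - 1, 2 * b)) ` Grid ((m + 1) div 2) (n div 2)" (is "_ = ?R")
proof
  show "Grid m n \<subseteq> ?R"
  proof (rule subrelI)
    fix i j assume "(i, j) \<in> Grid m n"
    then show "(i, j) \<in> ?R"
      by (cases i rule: even_or_pred_even_int; cases j rule: even_or_pred_even_int)
        (auto simp: Grid_parity_iff intro: rev_image_eqI)
  qed
qed (auto simp: Grid_parity_iff)

lemma Grid_even_labels:
  "{x i j | i j. (i, j) \<in> Grid m n \<and> even (i + j)} =
    (\<lambda>(a, b). x (2 * a - 1) (2 * b - 1)) ` Grid ((m + 1) div 2) ((n + 1) div 2) \<union>
    (\<lambda>(a, b). x (2 * a) (2 * b)) ` Grid (m div 2) (n div 2)"
  by (subst Grid_parity_Un) fastforce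

lemma Grid_odd_labels:
  "{x i j | i j. (i, j) \<in> Grid m n \<and> odd (i + j)} =
    (\<lambda>(a, b). x (2 * a) (2 * b - 1)) ` Grid (m div 2) ((n + 1) div 2) \<union>
    (\<lambda>(a, b). x (2 * a - 1) (2 * b)) ` Grid ((m + 1) div 2) (n div 2)"
  by (subst Grid_parity_Un) fastforce

lemma block_columns_image_eq:
  fixes m c s k :: int
  assumes "0 < m" "0 \<le> s" "s + c \<le> m"
  shows "(\<lambda>(a, b). m * (b - 1) + s + a) ` Grid c k =
    {v \<in> {1 .. m * k}. (v - 1) mod m \<in> {s ..< s + c}}" (is "?L = ?R")
proof
  have "m * (b - 1) + s + a \<in> ?R" if "(a, b) \<in> Grid c k" for a b
  proof -
    have a: "1 \<le> a" "a \<le> c" using that by (simp_all add: Grid_def)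
    have "(m * (b - 1) + s + a - 1) mod m = (s + a - 1 + m * (b - 1)) mod m"
      by (simp add: algebra_simps)
    also have "\<dots> = s + a - 1" using a assms by (simp add: mod_mult_self2)
    finally have "(m * (b - 1) + s + a - 1) mod m = s + a - 1" .
    moreover have "0 \<le> m * (b - 1)" "m * (b - 1) \<le> m * (k - 1)"
      using that assms by (auto simp: Grid_def)
    moreover have "m * (k - 1) = m * k - m" by (simp add: right_diff_distrib)
    ultimately show ?thesis
      using a assms unfolding mem_Collect_eq atLeastAtMost_iff atLeastLessThan_iff by linarith
  qed
  then show "?L \<subseteq> ?R" by auto
next
  show "?R \<subseteq> ?L"
  proof
    fix v assume v: "v \<in> ?R"
    define b r where "b = (v - 1) div m" and "r = (v - 1) mod m"
    have v_eq: "v = m * b + r + 1" by (simp add: b_def r_def)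
    have r: "s \<le> r" "r < s + c" using v by (simp_all add: r_def)
    have "0 \<le> b" using v assms by (simp add: b_def pos_imp_zdiv_nonneg_iff)
    moreover have "v \<le> m * k" using v by simp
    then have "m * b < m * k" using v_eq r assms by linarith
    ultimately have "(r + 1 - s, b + 1) \<in> Grid c k"
      using r assms by (simp add: Grid_def mult_less_cancel_left)
    then show "v \<in> ?L" by (rule rev_image_eqI) (simp add: v_eq)
  qed
qed

lemma alternating_blocks_Un:
  fixes m c q :: int
  assumes "0 < m" "0 \<le> c" "c \<le> m"
  shows "(\<lambda>(a, b). m * (b - 1) + a) ` Grid c (q + 1) \<union>
    (\<lambda>(a, b). m * (b - 1) + c + a) ` Grid (m - c) q = {1 .. m * q + c}"
proof -
  have bound_iff: "v \<le> m * q + c \<longleftrightarrow>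
      v \<le> m * (q + 1) \<and> (v - 1) mod m < c \<or> v \<le> m * q \<and> c \<le> (v - 1) mod m" for v
  proof -
    define b r where "b = (v - 1) div m" and "r = (v - 1) mod m"
    have v_eq: "v = m * b + r + 1" by (simp add: b_def r_def)
    have r: "0 \<le> r" "r < m" using assms by (simp_all add: r_def)
    consider (below) "b + 1 \<le> q" | (last_block) "b = q" | (above) "q + 1 \<le> b" by linarith
    then show ?thesis
    proof cases
      case below
      then have "m * (b + 1) \<le> m * q" using assms by simp
      then show ?thesis
        using v_eq r assms unfolding r_def[symmetric] distrib_left by linarith
    next
      case last_block
      then show ?thesis
        using v_eq r assms unfolding r_def[symmetric] distrib_left by auto
    next
      case above
      then have "m * (q + 1) \<le> m * b" using assms by simp
      then show ?thesis
        using v_eq r assms unfolding r_def[symmetric] distrib_left by linarith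
    qed
  qed
  show ?thesis
    using block_columns_image_eq[of m 0 c "q + 1"] block_columns_image_eq[of m c "m - c" q]
      assms by (auto simp: bound_iff)
qed

lemma C4_faces_magic_iff:
  fixes x :: "int \<Rightarrow> int \<Rightarrow> 'a :: comm_monoid_add"
  shows "(\<forall>F \<in> C4_faces m n. (\<Sum>(i, j) \<in> F. x i j) = s) \<longleftrightarrow>
    (\<forall>i j. 1 \<le> i \<and> i \<le> m - 1 \<and> 1 \<le> j \<and> j \<le> n - 1 \<longrightarrow>
      x i j + x (i + 1) j + x i (j + 1) + x (i + 1) (j + 1) = s)"
proof -
  have "(\<Sum>(k, l) \<in> {(i, j), (i + 1, j), (i, j + 1), (i + 1, j + 1)}. x k l) =
      x i j + x (i + 1) j + x i (j + 1) + x (i + 1) (j + 1)" for i j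
    by (simp add: add.assoc)
  note face_sum = this[symmetric]
  show ?thesis unfolding C4_faces_def face_sum by blast
qed

lemma partial_bicentrally_balanced_transpose:
  assumes "partial_bicentrally_balanced M N m n x"
  shows "partial_bicentrally_balanced N M n m (\<lambda>i j. x j i)"
proof -
  have labels: "{x j i | i j. (i, j) \<in> Grid n m \<and> P (i + j)} =
      {x i j | i j. (i, j) \<in> Grid m n \<and> P (i + j)}" for P
  proof -
    have "(i, j) \<in> Grid n m \<and> P (i + j) \<longleftrightarrow> (j, i) \<in> Grid m n \<and> P (j + i)" for i j
      by (auto simp: Grid_def add.commute)
    then show ?thesis by blast
  qed
  have faces: "(\<forall>F \<in> C4_faces n m. (\<Sum>(i, j) \<in> F. x j i) = s) \<longleftrightarrow>
      (\<forall>F \<in> C4_faces m n. (\<Sum>(i, j) \<in> F. x i j) = s)" for s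
    unfolding C4_faces_magic_iff by (auto simp: algebra_simps)
  have central: "(\<forall>(i, j) \<in> Grid n m. P (i + j) \<longrightarrow> x j i + x (m + 1 - j) (n + 1 - i) = s) \<longleftrightarrow>
      (\<forall>(i, j) \<in> Grid m n. P (i + j) \<longrightarrow> x i j + x (m + 1 - i) (n + 1 - j) = s)" for P s
    unfolding Grid_def by (auto simp: add.commute)
  have comm: "2 * N * M = 2 * M * N" "N * M = M * N" "n * m = m * n"
    "half_ceil n + k = k + half_ceil n" "k + half_ceil m = half_ceil m + k" for k
    by simp_all
  show ?thesis
    using assms unfolding partial_bicentrally_balanced_def faces comm
      labels[of even] labels[of "\<lambda>k. odd k"] central[of even] central[of "\<lambda>k. odd k"]
    by - (elim conjE, intro conjI)
qed

lemma half_ceil_odd: "m = 2 * p + 1 \<Longrightarrow> half_ceil m = p + 1"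
  by (simp add: half_ceil_def half_floor_def)

lemma odd_mult_odd_div_2:
  fixes m n p q :: int
  assumes "m = 2 * p + 1" "n = 2 * q + 1"
  shows "(m * n + 1) div 2 = m * q + p + 1"
    and "(m * n + 3) div 2 = m * q + p + 2"
    and "(m * n - 3) div 2 = m * q + p - 1"
proof -
  have "m * n = 2 * (m * q + p) + 1" using assms by (simp add: algebra_simps)
  then show "(m * n + 1) div 2 = m * q + p + 1" "(m * n + 3) div 2 = m * q + p + 2"
    "(m * n - 3) div 2 = m * q + p - 1" by presburger+
qed

lemma HALL_face_sum:
  assumes "odd m"
  shows "HALL M N m n i j + HALL M N m n (i + 1) j + HALL M N m n i (j + 1)
    + HALL M N m n (i + 1) (j + 1) = 2 * M * N + 3"
proof -
  obtain p where m: "m = 2 * p + 1" using assms by (rule oddE)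
  show ?thesis
    unfolding HALL_def Let_def half_ceil_odd[OF m] unfolding m
    by (cases "even i"; cases "even j"; elim evenE oddE) (simp_all add: algebra_simps)
qed

lemma HALL_even_labels:
  assumes "odd m" "m \<ge> 1" "odd n"
  shows "{HALL M N m n i j | i j. (i, j) \<in> Grid m n \<and> even (i + j)} = {1 .. (m * n + 1) div 2}"
proof -
  obtain p where m: "m = 2 * p + 1" using assms(1) by (rule oddE)
  obtain q where n: "n = 2 * q + 1" using assms(3) by (rule oddE)
  have "{HALL M N m n i j | i j. (i, j) \<in> Grid m n \<and> even (i + j)} =
      (\<lambda>(a, b). m * (b - 1) + a) ` Grid (p + 1) (q + 1) \<union>
      (\<lambda>(a, b). m * (b - 1) + (p + 1) + a) ` Grid (m - (p + 1)) q"
    unfolding Grid_even_labels HALL_eqs half_ceil_odd[OF m] by (simp add: m n add.commute)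
  also have "\<dots> = {1 .. m * q + (p + 1)}"
    using assms m by (intro alternating_blocks_Un) auto
  also have "m * q + (p + 1) = (m * n + 1) div 2"
    by (simp add: odd_mult_odd_div_2[OF m n])
  finally show ?thesis .
qed

lemma HALL_odd_labels:
  assumes "odd m" "m \<ge> 1" "odd n"
  shows "{HALL M N m n i j | i j. (i, j) \<in> Grid m n \<and> odd (i + j)} =
    {M * N - (m * n - 3) div 2 .. M * N}"
proof -
  obtain p where m: "m = 2 * p + 1" using assms(1) by (rule oddE)
  obtain q where n: "n = 2 * q + 1" using assms(3) by (rule oddE)
  have HALL_descending:
    "HALL M N m n (2 * a) (2 * b - 1) = M * N + 1 - (m * (b - 1) + a)"
    "HALL M N m n (2 * a - 1) (2 * b) = M * N + 1 - (m * (b - 1) + p + a)" for a b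
    unfolding HALL_eqs half_ceil_odd[OF m] by (simp_all add: m algebra_simps)
  have "{HALL M N m n i j | i j. (i, j) \<in> Grid m n \<and> odd (i + j)} =
      (\<lambda>k. M * N + 1 - k) ` ((\<lambda>(a, b). m * (b - 1) + a) ` Grid p (q + 1) \<union>
        (\<lambda>(a, b). m * (b - 1) + p + a) ` Grid (m - p) q)"
    unfolding Grid_odd_labels HALL_descending image_Un image_image case_prod_beta
    by (simp add: m n add.commute)
  also have "\<dots> = (\<lambda>k. M * N + 1 - k) ` {1 .. m * q + p}"
    using assms m by (subst alternating_blocks_Un) auto
  also have "\<dots> = {M * N - (m * n - 3) div 2 .. M * N}"
    by (simp add: odd_mult_odd_div_2[OF m n])
  finally show ?thesis .
qed

lemma HALL_central_sum:
  assumes "odd m" "odd n"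
  shows "HALL M N m n i j + HALL M N m n (m + 1 - i) (n + 1 - j) =
    (if even (i + j) then (m * n + 3) div 2 else 2 * M * N - (m * n - 3) div 2)"
proof -
  obtain p where m: "m = 2 * p + 1" using assms(1) by (rule oddE)
  obtain q where n: "n = 2 * q + 1" using assms(2) by (rule oddE)
  have reflect:
    "m + 1 - 2 * a = 2 * (p + 1 - a)" "m + 1 - (2 * a - 1) = 2 * (p + 2 - a) - 1"
    "n + 1 - 2 * a = 2 * (q + 1 - a)" "n + 1 - (2 * a - 1) = 2 * (q + 2 - a) - 1" for a
    by (simp_all add: m n)
  show ?thesis
    unfolding odd_mult_odd_div_2[OF m n]
    by (cases i rule: even_or_pred_even_int; cases j rule: even_or_pred_even_int;
        simp only: reflect HALL_eqs half_ceil_odd[OF m]; simp add: m algebra_simps)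
qed

lemma HALL_row_add_2:
  "HALL M N m n (i + 2) j = HALL M N m n i j + (if even (i + j) then 1 else - 1)"
  by (cases "even i"; cases "even j"; elim evenE oddE)
    (simp_all add: HALL_def Let_def algebra_simps)

lemma HALL_column_add_2:
  "HALL M N m n i (j + 2) = HALL M N m n i j + (if even (i + j) then m else - m)"
  by (cases "even i"; cases "even j"; elim evenE oddE)
    (simp_all add: HALL_def Let_def algebra_simps)

lemma partial_bicentrally_balanced_HALL:
  assumes "odd m" "m \<ge> 1" "odd n"
  shows "partial_bicentrally_balanced M N m n (HALL M N m n)"
  unfolding partial_bicentrally_balanced_def C4_faces_magic_iff
    HALL_even_labels[OF assms] HALL_odd_labels[OF assms]
  using assms
  by (auto simp: HALL_face_sum HALL_central_sum HALL_row_add_2 HALL_column_add_2)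

lemma VALL_eq_HALL_transpose: "VALL M N m n = (\<lambda>i j. HALL N M n m j i)"
  by (intro ext) (auto simp: VALL_def HALL_def Let_def)

theorem theorem35:
  fixes m n M N :: int
  assumes "odd m" and "m \<ge> 3" and "odd n" and "n \<ge> 3"
    and "odd M" and "M \<ge> m" and "odd N" and "N \<ge> n"
  shows "partial_bicentrally_balanced M N m n (HALL M N m n) \<and>
         partial_bicentrally_balanced M N m n (VALL M N m n)"
proof
  show "partial_bicentrally_balanced M N m n (HALL M N m n)"
    using assms by (intro partial_bicentrally_balanced_HALL) auto
  have "partial_bicentrally_balanced N M n m (HALL N M n m)"
    using assms by (intro partial_bicentrally_balanced_HALL) auto
  then show "partial_bicentrally_balanced M N m n (VALL M N m n)"
    unfolding VALL_eq_HALL_transpose by (rule partial_bicentrally_balanced_transpose)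
qed

end
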